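(* If a continuum $Y$ is a 2-to-1 retract of a continuum, then $Y$ is a $k$-to-1 retract of a continuum for each integer $k>2$.
   Context: A continuum is a (nonempty) connected, compact metric space. For a positive integer $k$, a function is $k$-to-1 if the preimage of each point of its image has exactly $k$ points. A continuum $Y$ is a $k$-to-1 retract (of a continuum) if there is a continuum $X$ and a continuous $k$-to-1 retraction from $X$ onto a subcontinuum of $X$ that is homeomorphic to $Y$. *)

theory Defs
  imports "HOL-Analysis.Analysis"
begin

definition continuum :: "'a metric \<Rightarrow> bool"
  where "continuum X \<longleftrightarrow>
    mspace X \<noteq> {} \<and> connected_space (mtopology_of X) \<and> compact_space (mtopology_of X)"

text \<open>The condition \<open>0 < k\<close> rules out \<open>card\<close> being \<open>0\<close> because of an infinite fibre.\<close>

definition k_to_1_on :: "nat \<Rightarrow> ('a \<Rightarrow> 'b) \<Rightarrow> 'a set \<Rightarrow> bool"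
  where "k_to_1_on k f S \<longleftrightarrow> 0 < k \<and> (\<forall>y \<in> f ` S. card {x \<in> S. f x = y} = k)"

definition k_to_1_retract_of :: "nat \<Rightarrow> 'a metric \<Rightarrow> 'b metric \<Rightarrow> bool"
  where "k_to_1_retract_of k Y X \<longleftrightarrow>
    (\<exists>Z r. Z \<subseteq> mspace X \<and> continuum (submetric X Z) \<and>
       retraction_maps (mtopology_of X) (mtopology_of (submetric X Z)) r id \<and>
       k_to_1_on k r (mspace X) \<and>
       mtopology_of (submetric X Z) homeomorphic_space mtopology_of Y)"

text \<open>
  HOL cannot quantify existentially over types, so the underlying set of the continuum \<open>X\<close> is
  taken inside the type \<open>nat \<Rightarrow> real\<close>; its metric is arbitrary. This is no restriction, since
  every continuum is isometric to one of this form: see \<open>k_to_1_retractI\<close> below, where \<open>X\<close> has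
  an arbitrary type.
\<close>

definition k_to_1_retract :: "nat \<Rightarrow> 'a metric \<Rightarrow> bool"
  where "k_to_1_retract k Y \<longleftrightarrow>
    (\<exists>X :: (nat \<Rightarrow> real) metric. continuum X \<and> k_to_1_retract_of k Y X)"

lemma compact_metric_inj_sequences:
  fixes X :: "'b metric"
  assumes "compact_space (mtopology_of X)" "mspace X \<noteq> {}"
  shows "\<exists>g :: 'b \<Rightarrow> nat \<Rightarrow> real. inj_on g (mspace X)"
proof -
  interpret Metric_space "mspace X" "mdist X" by simp
  have "mtotally_bounded (mspace X)"
    using assms(1) compact_space_eq_mcomplete_mtotally_bounded by (simp add: mtopology_of_def)
  then have "\<forall>n. \<exists>K. finite K \<and> K \<subseteq> mspace X \<and>
      mspace X \<subseteq> (\<Union>x\<in>K. mball x (1 / real (Suc n)))"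
    unfolding mtotally_bounded_def by simp
  then obtain K where K: "\<And>n. finite (K n)" "\<And>n. K n \<subseteq> mspace X"
      "\<And>n. mspace X \<subseteq> (\<Union>x\<in>K n. mball x (1 / real (Suc n)))"
    by metis
  define C where "C = (\<Union>n. K n)"
  have "countable C"
    unfolding C_def using K(1) by (simp add: countable_finite)
  have "C \<noteq> {}"
    using K(3)[of 0] assms(2) unfolding C_def by auto
  define g where "g x = (\<lambda>i. mdist X x (from_nat_into C i))" for x
  have "x = y" if xy: "x \<in> mspace X" "y \<in> mspace X" "g x = g y" for x y
  proof (rule ccontr)
    assume "x \<noteq> y"
    then have "0 < mdist X x y / 2" using xy by (simp add: less_le)
    then obtain n where n: "1 / real (Suc n) < mdist X x y / 2"
      using nat_approx_posE by metis
    obtain c where c: "c \<in> K n" "x \<in> mball c (1 / real (Suc n))"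
      using K(3)[of n] xy(1) by blast
    then have "c \<in> C" "c \<in> mspace X" using K(2) by (auto simp: C_def)
    then obtain i where "from_nat_into C i = c"
      using from_nat_into_surj[OF \<open>countable C\<close>] by metis
    then have "mdist X x c = mdist X y c" using fun_cong[OF xy(3), of i] by (simp add: g_def)
    moreover have "mdist X x c < 1 / real (Suc n)" using c by (simp add: mdist_commute)
    moreover have "mdist X x y \<le> mdist X x c + mdist X y c"
      using mdist_triangle[OF xy(1) \<open>c \<in> mspace X\<close> xy(2)] by (simp add: mdist_commute)
    ultimately show False using n by linarith
  qed
  then show ?thesis by (auto simp: inj_on_def)
qed

lemma isometric_copy:
  fixes X :: "'b metric" and g :: "'b \<Rightarrow> 'c"
  assumes g: "inj_on g (mspace X)"
  shows "\<exists>X'. mspace X' = g ` mspace X \<and>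
    (\<forall>x\<in>mspace X. \<forall>y\<in>mspace X. mdist X' (g x) (g y) = mdist X x y) \<and>
    homeomorphic_maps (mtopology_of X) (mtopology_of X') g (inv_into (mspace X) g)"
proof -
  define S where "S = mspace X"
  define h where "h = inv_into S g"
  have hg: "h (g x) = x" if "x \<in> S" for x using g that by (simp add: h_def S_def)
  define d where "d = (\<lambda>u v. mdist X (h u) (h v))"
  interpret m': Metric_space "g ` S" d
  proof
    fix x y z
    show "0 \<le> d x y" by (simp add: d_def)
    show "d x y = d y x" unfolding d_def by (rule mdist_commute)
    assume xyz: "x \<in> g ` S" "y \<in> g ` S"
    then have "h x \<in> mspace X" "h y \<in> mspace X" by (auto simp: hg S_def[symmetric])
    then show "d x y = 0 \<longleftrightarrow> x = y" using xyz by (auto simp: d_def hg)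
    assume "z \<in> g ` S"
    then show "d x z \<le> d x y + d y z"
      using xyz unfolding d_def by (intro mdist_triangle) (auto simp: hg S_def[symmetric])
  qed
  define X' where "X' = metric (g ` S, d)"
  have sp: "mspace X' = g ` S" "mdist X' = d" by (auto simp: X'_def)
  have "continuous_map (mtopology_of X) (mtopology_of X') g"
    by (rule Lipschitz_continuous_imp_continuous_map)
       (auto simp: Lipschitz_continuous_map_def sp d_def hg S_def[symmetric] intro!: exI[of _ 1])
  moreover have "continuous_map (mtopology_of X') (mtopology_of X) h"
    by (rule Lipschitz_continuous_imp_continuous_map)
       (auto simp: Lipschitz_continuous_map_def sp d_def hg S_def[symmetric] intro!: exI[of _ 1])
  ultimately have "homeomorphic_maps (mtopology_of X) (mtopology_of X') g h"
    by (auto simp: homeomorphic_maps_def sp hg S_def[symmetric])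
  then show ?thesis
    by (intro exI[of _ X']) (auto simp: sp d_def hg S_def[symmetric] h_def[symmetric])
qed

lemma continuum_homeomorphic:
  assumes "mtopology_of X homeomorphic_space mtopology_of X'" "continuum X"
  shows "continuum X'"
  using assms homeomorphic_connected_space[OF assms(1)] homeomorphic_compact_space[OF assms(1)]
    homeomorphic_empty_space[OF assms(1)]
  unfolding continuum_def by (simp flip: null_topspace_iff_trivial)

theorem k_to_1_retractI:
  fixes X :: "'b metric" and Y :: "'a metric"
  assumes X: "continuum X" and "k_to_1_retract_of k Y X"
  shows "k_to_1_retract k Y"
proof -
  obtain Z r where Z: "Z \<subseteq> mspace X" "continuum (submetric X Z)"
    and r: "retraction_maps (mtopology_of X) (mtopology_of (submetric X Z)) r id"
    and k: "k_to_1_on k r (mspace X)"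
    and Y: "mtopology_of (submetric X Z) homeomorphic_space mtopology_of Y"
    using assms(2) unfolding k_to_1_retract_of_def by blast
  obtain g :: "'b \<Rightarrow> nat \<Rightarrow> real" where g: "inj_on g (mspace X)"
    using compact_metric_inj_sequences X unfolding continuum_def by blast
  define h where "h = inv_into (mspace X) g"
  have hg: "h (g x) = x" if "x \<in> mspace X" for x using g that by (simp add: h_def)
  obtain X' where X': "mspace X' = g ` mspace X"
      "homeomorphic_maps (mtopology_of X) (mtopology_of X') g h"
    using isometric_copy[OF g] unfolding h_def by blast
  define Z' where "Z' = g ` Z"
  define r' where "r' = g \<circ> r \<circ> h"
  have Z': "Z' \<subseteq> mspace X'" using Z(1) X'(1) by (auto simp: Z'_def)
  have hm: "homeomorphic_maps (mtopology_of (submetric X Z)) (mtopology_of (submetric X' Z')) g h"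
    unfolding mtopology_of_submetric
    by (rule homeomorphic_maps_subtopologies[OF X'(2)]) (use Z(1) X'(1) in \<open>auto simp: Z'_def\<close>)
  then have hs: "mtopology_of (submetric X Z) homeomorphic_space mtopology_of (submetric X' Z')"
    unfolding homeomorphic_space_def by blast
  have cX': "continuum X'"
    using continuum_homeomorphic X X'(2) unfolding homeomorphic_space_def by blast
  have rc: "continuous_map (mtopology_of X) (mtopology_of (submetric X Z)) r"
    and rid: "\<And>x. x \<in> Z \<Longrightarrow> r x = x"
    using r Z(1) by (auto simp: retraction_maps_def)
  have rZ: "r x \<in> Z" if "x \<in> mspace X" for x
    using continuous_map_image_subset_topspace[OF rc] that by auto
  have "continuous_map (mtopology_of X') (mtopology_of (submetric X' Z')) r'"
    unfolding r'_def using X'(2) rc hm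
    by (auto simp: homeomorphic_maps_def intro!: continuous_map_compose)
  then have ret: "retraction_maps (mtopology_of X') (mtopology_of (submetric X' Z')) r' id"
    using Z(1) by (auto simp: retraction_maps_def mtopology_of_submetric
        continuous_map_from_subtopology Z'_def r'_def hg rid subset_iff)
  have "card {u \<in> mspace X'. r' u = r' (g x)} = k" if x: "x \<in> mspace X" for x
  proof -
    have r'g: "r' (g y) = r' (g x) \<longleftrightarrow> r y = r x" if "y \<in> mspace X" for y
      using that x rZ Z(1) inj_onD[OF g] by (auto simp: r'_def hg subset_iff)
    have "{u \<in> mspace X'. r' u = r' (g x)} = g ` {y \<in> mspace X. r y = r x}"
      by (auto simp: X'(1) r'g)
    moreover have "inj_on g {y \<in> mspace X. r y = r x}"
      by (rule inj_on_subset[OF g]) auto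
    ultimately show ?thesis using k x by (simp add: card_image k_to_1_on_def)
  qed
  then have k': "k_to_1_on k r' (mspace X')"
    using k by (auto simp: k_to_1_on_def X'(1))
  have "k_to_1_retract_of k Y X'"
    unfolding k_to_1_retract_of_def
    using Z' continuum_homeomorphic[OF hs Z(2)] ret k'
      homeomorphic_space_trans[OF iffD1[OF homeomorphic_space_sym hs] Y] by blast
  then show ?thesis using cX' unfolding k_to_1_retract_def by blast
qed

end

theory Submission
  imports Defs
begin

text \<open>
  Let \<open>r\<close> be a \<open>k\<close>-to-1 retraction of \<open>X\<close> onto \<open>Z\<close>. Glue \<open>n\<close> copies of \<open>X\<close> together along \<open>Z\<close> and
  apply \<open>r\<close> on every copy. A fibre of \<open>r\<close> contains exactly one point of \<open>Z\<close>, namely the point of \<open>Z\<close>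
  that it lies over; this point is shared by all the copies, while each of the other \<open>k - 1\<close> points
  now occurs \<open>n\<close> times. So the new retraction is \<open>(n * (k - 1) + 1)\<close>-to-1, and for \<open>k = 2\<close> this number
  is \<open>n + 1\<close>, which takes every value above \<open>2\<close>.

  The glued space needs no quotient: it is realised inside \<open>X \<times> \<real>\<close> as a fan of graphs. The function
  \<open>x \<mapsto> d x (r x)\<close> is continuous and vanishes precisely on \<open>Z\<close>, so the graphs of its multiples by
  \<open>0, ..., n - 1\<close> are copies of \<open>X\<close> any two of which meet exactly over \<open>Z\<close>. A finite union of
  continua through a common point is a continuum.
\<close>

text \<open>
  This is the amalgam of \<open>n\<close> copies of \<open>S\<close> along the zero set of \<open>f\<close>: multiples of \<open>f\<close> by different
  numbers agree exactly where \<open>f\<close> vanishes.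
\<close>

definition graph_fan :: "nat \<Rightarrow> ('a \<Rightarrow> real) \<Rightarrow> 'a set \<Rightarrow> ('a \<times> real) set"
  where "graph_fan n f S = (\<Union>i<n. (\<lambda>x. (x, real i * f x)) ` S)"

text \<open>Every graph is a continuous image of \<open>X\<close>, and the zero \<open>z\<close> gives all of them a common point.\<close>

lemma continuum_graph_fan:
  fixes X :: "'a metric"
  assumes X: "continuum X"
    and f: "continuous_map (mtopology_of X) euclideanreal f"
    and z: "z \<in> mspace X" "f z = 0"
    and n: "0 < n"
  shows "continuum (submetric (prod_metric X euclidean_metric) (graph_fan n f (mspace X)))"
proof -
  define P where "P = prod_topology (mtopology_of X) euclideanreal"
  define g where "g i x = (x, real i * f x)" for i :: nat and x
  define \<G> where "\<G> = (\<lambda>i. g i ` mspace X) ` {..<n}"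
  have fan: "graph_fan n f (mspace X) = \<Union>\<G>"
    by (auto simp: graph_fan_def \<G>_def g_def)
  have top: "mtopology_of (prod_metric X euclidean_metric) = P"
    by (simp add: P_def mtopology_of_prod_metric)
  have g: "continuous_map (mtopology_of X) P (g i)" for i
    unfolding P_def g_def
    by (intro continuous_map_pairedI continuous_map_real_mult f) auto
  have "connectedin P (\<Union>\<G>)"
  proof (rule connectedin_Union)
    show "connectedin P C" if "C \<in> \<G>" for C
      using that X connectedin_continuous_map_image[OF g]
      by (auto simp: \<G>_def continuum_def connectedin_topspace simp flip: topspace_mtopology_of)
    have "(z, 0) \<in> g i ` mspace X" for i
      using z by (auto simp: g_def image_iff intro!: bexI[of _ z])
    then show "\<Inter>\<G> \<noteq> {}" by (auto simp: \<G>_def)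
  qed
  moreover have "compactin P (\<Union>\<G>)"
  proof (rule compactin_Union)
    show "finite \<G>" by (simp add: \<G>_def)
    show "compactin P C" if "C \<in> \<G>" for C
      using that X image_compactin[OF _ g]
      by (auto simp: \<G>_def continuum_def compact_space_def simp flip: topspace_mtopology_of)
  qed
  moreover have "(z, 0) \<in> \<Union>\<G>"
    using z n by (auto simp: \<G>_def g_def image_iff)
  moreover have "\<Union>\<G> \<subseteq> mspace (prod_metric X euclidean_metric)"
    by (auto simp: \<G>_def g_def)
  ultimately show ?thesis
    unfolding continuum_def fan mtopology_of_submetric top
    by (auto simp: connectedin_def compactin_subspace)
qed

text \<open>
  Points of \<open>F\<close> other than the zero \<open>y\<close> of \<open>f\<close> are counted once for each of the \<open>n\<close> graphs, \<open>y\<close> once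
  in total.
\<close>

lemma card_graph_fan:
  assumes F: "finite F" "y \<in> F" and f: "\<And>x. x \<in> F \<Longrightarrow> f x = 0 \<longleftrightarrow> x = y" and n: "0 < n"
  shows "card (graph_fan n f F) = n * (card F - 1) + 1"
proof -
  define q where "q = (\<lambda>(x, i). (x, real i * f x))"
  have split: "graph_fan n f F = insert (y, 0) (q ` ((F - {y}) \<times> {..<n}))"
  proof
    show "graph_fan n f F \<subseteq> insert (y, 0) (q ` ((F - {y}) \<times> {..<n}))"
      using f F by (auto simp: graph_fan_def q_def image_iff)
    show "insert (y, 0) (q ` ((F - {y}) \<times> {..<n})) \<subseteq> graph_fan n f F"
      using f F n by (force simp: graph_fan_def q_def image_iff)
  qed
  have "inj_on q ((F - {y}) \<times> {..<n})"
    using f by (auto simp: inj_on_def q_def)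
  then have "card (q ` ((F - {y}) \<times> {..<n})) = (card F - 1) * n"
    using F by (simp add: card_image card_cartesian_product)
  moreover have "(y, 0) \<notin> q ` ((F - {y}) \<times> {..<n})" by (auto simp: q_def)
  ultimately show ?thesis
    unfolding split using F by simp
qed

text \<open>
  A fibre of the new retraction is the fan over a fibre of \<open>r\<close>, in which the point of \<open>Z\<close> is the only
  zero of \<open>f\<close>.
\<close>

theorem k_to_1_retract_amalgam:
  fixes Y :: "'a metric"
  assumes "k_to_1_retract k Y" and n: "0 < n"
  shows "k_to_1_retract (n * (k - 1) + 1) Y"
proof -
  obtain X :: "(nat \<Rightarrow> real) metric" and Z r where X: "continuum X"
    and Z: "Z \<subseteq> mspace X" "continuum (submetric X Z)"
    and r: "retraction_maps (mtopology_of X) (mtopology_of (submetric X Z)) r id"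
    and k: "k_to_1_on k r (mspace X)"
    and Y: "mtopology_of (submetric X Z) homeomorphic_space mtopology_of Y"
    using assms(1) unfolding k_to_1_retract_def k_to_1_retract_of_def by blast
  have rc: "continuous_map (mtopology_of X) (mtopology_of (submetric X Z)) r"
    and rid: "\<And>x. x \<in> Z \<Longrightarrow> r x = x"
    using r Z(1) by (auto simp: retraction_maps_def)
  have rZ: "r x \<in> Z" if "x \<in> mspace X" for x
    using continuous_map_image_subset_topspace[OF rc] that by auto
  have rX: "continuous_map (mtopology_of X) (mtopology_of X) r"
    using rc by (simp add: mtopology_of_submetric continuous_map_in_subtopology)
  \<comment> \<open>The distance to \<open>Z\<close> would also do, but here the zero set is immediate from \<open>r\<close> fixing \<open>Z\<close>.\<close>
  define f where "f x = mdist X x (r x)" for x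
  have f: "continuous_map (mtopology_of X) euclideanreal f"
    unfolding f_def by (intro continuous_map_mdist rX) auto
  have f0: "f x = 0 \<longleftrightarrow> x = r x" if "x \<in> mspace X" for x
    using that rZ[OF that] Z(1) by (auto simp: f_def)
  obtain z where z: "z \<in> Z" using Z(2) by (auto simp: continuum_def)
  define S where "S = graph_fan n f (mspace X)"
  define W where "W = submetric (prod_metric X euclidean_metric) S"
  define Z' where "Z' = Z \<times> {0::real}"
  define r' where "r' = (\<lambda>p::(nat \<Rightarrow> real) \<times> real. (r (fst p), 0::real))"
  have S: "S \<subseteq> mspace X \<times> UNIV" by (auto simp: S_def graph_fan_def)
  then have spW: "mspace W = S" by (auto simp: W_def)
  have cW: "continuum W"
    unfolding W_def S_def
    by (rule continuum_graph_fan[OF X f _ _ n]) (use z Z(1) rid f0 in auto)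
  have Z'S: "Z' \<subseteq> S"
  proof -
    have "(x, 0) \<in> S" if "x \<in> Z" for x
    proof -
      have "x \<in> mspace X" using that Z(1) by blast
      then show ?thesis using n by (auto simp: S_def graph_fan_def image_iff intro!: bexI[of _ 0])
    qed
    then show ?thesis by (auto simp: Z'_def)
  qed
  let ?P = "prod_topology (mtopology_of X) euclideanreal"
  have topW: "mtopology_of W = subtopology ?P S"
    by (simp add: W_def mtopology_of_submetric mtopology_of_prod_metric)
  have topZ': "mtopology_of (submetric W Z') = subtopology ?P Z'"
    using Z'S by (simp add: topW mtopology_of_submetric subtopology_subtopology Int_absorb1)
  have topZ: "mtopology_of (submetric X Z) = subtopology (mtopology_of X) Z"
    by (simp add: mtopology_of_submetric)
  have "homeomorphic_maps (mtopology_of (submetric X Z)) (mtopology_of (submetric W Z'))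
      (\<lambda>x. (x, 0)) fst"
    unfolding homeomorphic_maps_def topZ topZ'
    by (auto simp: Z'_def continuous_map_in_subtopology continuous_map_pairwise o_def
        continuous_map_from_subtopology continuous_map_fst)
  then have hs: "mtopology_of (submetric X Z) homeomorphic_space mtopology_of (submetric W Z')"
    unfolding homeomorphic_space_def by blast
  have "continuous_map (mtopology_of W) (mtopology_of (submetric W Z')) r'"
  proof -
    have "continuous_map (subtopology ?P S) (mtopology_of X) (r \<circ> fst)"
      using continuous_map_compose[OF continuous_map_fst rX]
      by (rule continuous_map_from_subtopology)
    then have "continuous_map (subtopology ?P S) ?P r'"
      unfolding r'_def o_def by (intro continuous_map_pairedI) auto
    moreover have "r' p \<in> Z'" if "p \<in> S" for p
      using that S rZ by (auto simp: r'_def Z'_def)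
    ultimately show ?thesis
      unfolding topW topZ' by (auto simp: continuous_map_in_subtopology)
  qed
  moreover have "continuous_map (mtopology_of (submetric W Z')) (mtopology_of W) id"
    by (simp add: mtopology_of_submetric continuous_map_from_subtopology)
  moreover have "r' p = p" if "p \<in> Z'" for p
    using that rid by (auto simp: r'_def Z'_def)
  ultimately have ret: "retraction_maps (mtopology_of W) (mtopology_of (submetric W Z')) r' id"
    by (auto simp: retraction_maps_def)
  have "card {p \<in> S. r' p = r' u} = n * (k - 1) + 1" if u: "u \<in> S" for u
  proof -
    define y where "y = r (fst u)"
    define F where "F = {x \<in> mspace X. r x = y}"
    have fu: "fst u \<in> mspace X" using u S by auto
    then have "card F = k" "0 < k"
      using k by (auto simp: k_to_1_on_def F_def y_def)
    then have "finite F" by (auto intro: card_ge_0_finite)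
    have "y \<in> Z" using rZ[OF fu] by (simp add: y_def)
    then have "y \<in> F" using Z(1) rid by (auto simp: F_def)
    have "{p \<in> S. r' p = r' u} = graph_fan n f F"
      by (auto simp: S_def graph_fan_def F_def r'_def y_def, blast)
    moreover have "card (graph_fan n f F) = n * (card F - 1) + 1"
      by (rule card_graph_fan[OF \<open>finite F\<close> \<open>y \<in> F\<close> _ n]) (auto simp: F_def f0)
    ultimately show ?thesis using \<open>card F = k\<close> by simp
  qed
  then have "k_to_1_on (n * (k - 1) + 1) r' (mspace W)"
    by (auto simp: k_to_1_on_def spW)
  then have "k_to_1_retract_of (n * (k - 1) + 1) Y W"
    unfolding k_to_1_retract_of_def
    using Z'S ret continuum_homeomorphic[OF hs Z(2)]
      homeomorphic_space_trans[OF iffD1[OF homeomorphic_space_sym hs] Y]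
    by (auto simp: spW)
  then show ?thesis by (rule k_to_1_retractI[OF cW])
qed

theorem corollary7:
  fixes Y :: "'a metric" and k :: nat
  assumes "continuum Y"
    and "k_to_1_retract 2 Y"
    and "k > 2"
  shows "k_to_1_retract k Y"
  using k_to_1_retract_amalgam[OF assms(2), of "k - 1"] assms(3) by simp

end
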